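(* Let $n\geq 5$ be odd. Let $D$ be the distance matrix of the wheel graph with $n$ vertices. Let $a=(0,-1,1,\ldots,-1,1)\in\mathbb{R}^n$ and $w=\frac14(5-n,1,\ldots,1)\in\mathbb{R}^n$, and let $\widetilde{L}$ be the $n\times n$ matrix such that $$D^{\dagger}=-\frac12\widetilde{L}+\frac{4}{n-1}ww^{t}.$$ Then $$(D+aa^{t})^{-1}a=\frac{1}{n-1}a,$$ $$D^{\dagger}=(D+aa^{t})^{-1}\left(I-\frac{1}{n-1}aa^{t}\right),$$ $$\widetilde{L}=-2\left((D+aa^{t})^{-1}-\frac{4}{n-1}ww^{t}\right)\left(I-\frac{1}{n-1}aa^{t}\right),$$ and $(D+aa^{t})^{-1}-\frac{4}{n-1}ww^{t}$ is negative semidefinite on $\mathrm{R}(D)$.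
   Context: The wheel graph $W(n)$ has center labeled $1$, adjacent to all other vertices, and the vertices $2,\ldots,n$ form a cycle of length $n-1$ in that order. Its distance matrix is $D=\begin{pmatrix}0&e^{t}\\ e&\mathrm{circ}(u)\end{pmatrix}$ with $u=(0,1,2,\ldots,2,1)\in\mathbb{R}^{n-1}$, where $e\in\mathbb{R}^{n-1}$ has all components $1$ and $\mathrm{circ}(u)$ is the circulant matrix whose first row is $u$ and each of whose subsequent rows is the cyclic right shift by one of the previous row. Vectors are regarded as column vectors; $t$ denotes transpose; $\mathrm{R}(D)$ is the range of $D$. The matrix $D+aa^{t}$ is invertible. $D^{\dagger}$ is the Moore--Penrose inverse: the unique matrix $X$ with $DXD=D$, $XDX=X$, $(DX)^{t}=DX$, $(XD)^{t}=XD$. A symmetric matrix $M$ is negative semidefinite on a subspace $\mathcal{W}$ if $x^{t}Mx\leq 0$ for all $x\in\mathcal{W}$. *)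

theory Defs
  imports
    "Graph_Theory.Pair_Digraph"
    "Graph_Theory.Shortest_Path"
    "Jordan_Normal_Form.Gauss_Jordan_Elimination"
begin

section \<open>The wheel graph and its distance matrix\<close>

definition wheel_graph :: "nat \<Rightarrow> nat pair_pre_digraph" where
  "wheel_graph n = \<lparr> pverts = {1..n},
     parcs = (let E = {(1, k) | k. k \<in> {2..n}} \<union> {(k, k + 1) | k. k \<in> {2..<n}} \<union> {(n, 2)}
              in E \<union> E\<inverse>) \<rparr>"

text \<open>
  With all arc weights equal to 1, the library's shortest-path function is the graph distance
  (the least number of edges of a walk).
\<close>

definition graph_dist :: "'a pair_pre_digraph \<Rightarrow> 'a \<Rightarrow> 'a \<Rightarrow> ereal" where
  "graph_dist G u v = wf_digraph.\<mu> (with_proj G) (\<lambda>_. 1) u v"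

text \<open>
  Matrix and vector indices start at 0, the vertices of the wheel at 1.
\<close>

definition wheel_distance_matrix :: "nat \<Rightarrow> real mat" where
  "wheel_distance_matrix n =
     mat n n (\<lambda>(i, j). real_of_ereal (graph_dist (wheel_graph n) (i + 1) (j + 1)))"

lemma wheel_graph_simps:
  "pverts (wheel_graph n) = {1..n}"
  "(u, v) \<in> parcs (wheel_graph n) \<longleftrightarrow>
     (u = 1 \<and> v \<in> {2..n}) \<or> (v = 1 \<and> u \<in> {2..n}) \<or>
     (v = u + 1 \<and> u \<in> {2..<n}) \<or> (u = v + 1 \<and> v \<in> {2..<n}) \<or>
     (u = n \<and> v = 2) \<or> (u = 2 \<and> v = n)"
  unfolding wheel_graph_def Let_def by auto

lemma pair_graph_wheel_graph:
  assumes "n \<ge> 4"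
  shows "pair_graph (wheel_graph n)"
proof
  have sub: "parcs (wheel_graph n) \<subseteq> {1..n} \<times> {1..n}"
    using assms by (auto simp: wheel_graph_simps)
  show "fst e \<in> pverts (wheel_graph n)" "snd e \<in> pverts (wheel_graph n)"
    if "e \<in> parcs (wheel_graph n)" for e
    using that sub by (auto simp: wheel_graph_simps(1))
  show "finite (pverts (wheel_graph n))"
    by (simp add: wheel_graph_simps)
  show "finite (parcs (wheel_graph n))"
    using sub by (rule finite_subset) simp
  show "fst e \<noteq> snd e" if "e \<in> parcs (wheel_graph n)" for e
    using that assms by (cases e) (auto simp: wheel_graph_simps)
  show "symmetric (with_proj (wheel_graph n))"
    unfolding symmetric_def by (rule symI) (auto simp: wheel_graph_simps)
qed

lemma graph_dist_wheel_graph: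
  assumes "n \<ge> 4" "u \<in> {1..n}" "v \<in> {1..n}"
  shows "graph_dist (wheel_graph n) u v =
    (if u = v then 0 else if (u, v) \<in> parcs (wheel_graph n) then 1 else 2)"
proof -
  let ?G = "wheel_graph n"
  interpret pair_graph ?G using pair_graph_wheel_graph[OF assms(1)] .
  have cost: "awalk_cost (\<lambda>_. 1) p = real (length p)" for p
    by (induction p) auto
  have aw: "awalk u p v \<longleftrightarrow> set p \<subseteq> parcs ?G \<and> pcas u p v" for p
    using assms by (simp add: awalk_def wheel_graph_simps)
  have eq: "\<mu> (\<lambda>_. 1) u v = ereal (real k)"
    if w: "awalk u q v" "length q = k" and m: "\<And>p. awalk u p v \<Longrightarrow> k \<le> length p" for q k
  proof (rule antisym)
    show "\<mu> (\<lambda>_. 1) u v \<le> ereal (real k)"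
      using min_cost_le_walk_cost[OF w(1), of "\<lambda>_. 1"] w(2) by (simp add: cost)
    show "ereal (real k) \<le> \<mu> (\<lambda>_. 1) u v"
      unfolding \<mu>_def by (rule INF_greatest) (use m in \<open>auto simp: cost\<close>)
  qed
  have pos: "length p \<ge> 1" if "awalk u p v" "u \<noteq> v" for p
    using that by (cases p) (auto simp: aw)
  have ge2: "length p \<ge> 2" if "awalk u p v" "u \<noteq> v" "(u, v) \<notin> parcs ?G" for p
  proof (cases p)
    case Nil
    then show ?thesis using that by (simp add: aw)
  next
    case (Cons e q)
    then show ?thesis using that by (cases q) (auto simp: aw)
  qed
  consider "u = v" | "u \<noteq> v" "(u, v) \<in> parcs ?G" | "u \<noteq> v" "(u, v) \<notin> parcs ?G"
    by blast
  then show ?thesis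
  proof cases
    case 1
    then have "awalk u [] v" using assms by (simp add: awalk_Nil_iff wheel_graph_simps)
    from eq[OF this, of 0] 1 show ?thesis by (simp add: graph_dist_def zero_ereal_def)
  next
    case 2
    then show ?thesis using eq[of "[(u, v)]" 1] pos by (simp add: aw graph_dist_def)
  next
    case 3
    then have "u \<noteq> 1" "v \<noteq> 1" using assms by (auto simp: wheel_graph_simps)
    then have "awalk u [(u, 1), (1, v)] v"
      using assms by (simp add: aw wheel_graph_simps)
    then show ?thesis using 3 eq[of "[(u, 1), (1, v)]" 2] ge2 by (simp add: graph_dist_def)
  qed
qed

definition circ :: "'a vec \<Rightarrow> 'a mat" where
  "circ u = (let m = dim_vec u in mat m m (\<lambda>(i, j). u $ ((j + m - i) mod m)))"

lemma wheel_distance_matrix_block: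
  assumes "n \<ge> 4"
  defines "u \<equiv> vec (n - 1) (\<lambda>i. if i = 0 then 0 else if i = 1 \<or> i = n - 2 then 1 else 2)"
    and "e \<equiv> vec (n - 1) (\<lambda>_. 1)"
  shows "wheel_distance_matrix n =
    four_block_mat (0\<^sub>m 1 1) (mat_of_row e) (mat_of_row e)\<^sup>T (circ u)" (is "_ = ?B")
proof (rule eq_matI)
  show dims: "dim_row (wheel_distance_matrix n) = dim_row ?B"
    "dim_col (wheel_distance_matrix n) = dim_col ?B"
    using assms by (auto simp: wheel_distance_matrix_def circ_def Let_def)
  fix i j assume ij: "i < dim_row ?B" "j < dim_col ?B"
  have n: "i < n" "j < n"
    using ij dims by (simp_all add: wheel_distance_matrix_def)
  have D: "wheel_distance_matrix n $$ (i, j) =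
      (if i = j then 0 else if (i + 1, j + 1) \<in> parcs (wheel_graph n) then 1 else 2)"
    using n assms(1) by (simp add: wheel_distance_matrix_def graph_dist_wheel_graph)
  show "wheel_distance_matrix n $$ (i, j) = ?B $$ (i, j)"
  proof (cases "i = 0 \<or> j = 0")
    case True
    then show ?thesis
      unfolding D using n assms(1)
      by (auto simp: wheel_graph_simps four_block_mat_def circ_def Let_def u_def e_def)
  next
    case False
    then obtain i' j' where ij': "i = Suc i'" "j = Suc j'"
      by (cases i; cases j) auto
    have lt: "i' < n - 1" "j' < n - 1" using n ij' by auto
    have B: "?B $$ (i, j) = u $ ((j' + (n - 1) - i') mod (n - 1))"
      using lt by (simp add: ij' four_block_mat_def circ_def Let_def u_def e_def)
    have r: "(j' + (n - 1) - i') mod (n - 1) =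
        (if i' \<le> j' then j' - i' else j' + (n - 1) - i')"
    proof (cases "i' \<le> j'")
      case True
      then have "j' + (n - 1) - i' = (j' - i') + (n - 1)" by simp
      then show ?thesis using True lt by (simp only: mod_add_self2) simp
    next
      case False
      then show ?thesis using lt by simp
    qed
    define k where "k = (if i' \<le> j' then j' - i' else j' + (n - 1) - i')"
    have k: "k < n - 1"
      using lt by (auto simp: k_def)
    have adj: "(i + 1, j + 1) \<in> parcs (wheel_graph n) \<longleftrightarrow>
        j' = i' + 1 \<or> i' = j' + 1 \<or> (i' = n - 2 \<and> j' = 0) \<or> (i' = 0 \<and> j' = n - 2)"
    proof -
      have *: "Suc i' + 1 = n \<longleftrightarrow> i' = n - 2" "Suc j' + 1 = n \<longleftrightarrow> j' = n - 2"
        using lt assms(1) by linarith+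
      have **: "Suc i' + 1 = 1 \<longleftrightarrow> False" "Suc j' + 1 = 1 \<longleftrightarrow> False"
        "Suc i' + 1 = 2 \<longleftrightarrow> i' = 0" "Suc j' + 1 = 2 \<longleftrightarrow> j' = 0"
        "Suc j' + 1 = Suc i' + 1 + 1 \<longleftrightarrow> j' = i' + 1"
        "Suc i' + 1 = Suc j' + 1 + 1 \<longleftrightarrow> i' = j' + 1"
        by simp_all
      have "j' = i' + 1 \<Longrightarrow> Suc i' + 1 \<in> {2..<n}" "i' = j' + 1 \<Longrightarrow> Suc j' + 1 \<in> {2..<n}"
        using lt unfolding atLeastLessThan_iff by linarith+
      then show ?thesis unfolding ij' wheel_graph_simps(2) * ** by blast
    qed
    have k0: "k = 0 \<longleftrightarrow> i' = j'"
      using lt by (auto simp: k_def)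
    have k1: "k = 1 \<or> k = n - 2 \<longleftrightarrow>
        j' = i' + 1 \<or> i' = j' + 1 \<or> (i' = n - 2 \<and> j' = 0) \<or> (i' = 0 \<and> j' = n - 2)"
    proof (cases "i' \<le> j'")
      case True
      then have "k = j' - i'" by (simp add: k_def)
      moreover have "j' - i' = 1 \<longleftrightarrow> j' = i' + 1"
        using True by linarith
      moreover have "j' - i' = n - 2 \<longleftrightarrow> i' = 0 \<and> j' = n - 2"
        using True lt by linarith
      ultimately show ?thesis using True lt by auto
    next
      case False
      then have "k = j' + (n - 1) - i'" by (simp add: k_def)
      moreover have "j' + (n - 1) - i' = 1 \<longleftrightarrow> i' = n - 2 \<and> j' = 0"
        using False lt assms(1) by linarith
      moreover have "j' + (n - 1) - i' = n - 2 \<longleftrightarrow> i' = j' + 1"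
        using False lt assms(1) by linarith
      ultimately show ?thesis using False lt by auto
    qed
    show ?thesis
      unfolding D B r adj k_def[symmetric]
      using k by (simp only: u_def index_vec ij' nat.inject k0 k1)
  qed
qed


section \<open>Matrix notions\<close>

text \<open>The matrix \<open>v v\<^sup>t\<close> for a column vector \<open>v\<close>.\<close>

definition outer_square :: "'a :: semiring_0 vec \<Rightarrow> 'a mat" where
  "outer_square v = (mat_of_row v)\<^sup>T * mat_of_row v"

definition is_moore_penrose_inverse :: "real mat \<Rightarrow> real mat \<Rightarrow> bool" where
  "is_moore_penrose_inverse A X \<longleftrightarrow>
     X \<in> carrier_mat (dim_col A) (dim_row A) \<and>
     A * X * A = A \<and> X * A * X = X \<and> (A * X)\<^sup>T = A * X \<and> (X * A)\<^sup>T = X * A"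

definition moore_penrose_inverse :: "real mat \<Rightarrow> real mat" where
  "moore_penrose_inverse A = (THE X. is_moore_penrose_inverse A X)"

lemma is_moore_penrose_inverse_unique:
  assumes "is_moore_penrose_inverse A X" "is_moore_penrose_inverse A Y"
  shows "X = Y"
proof -
  define r c where "r = dim_row A" and "c = dim_col A"
  have A: "A \<in> carrier_mat r c" and X: "X \<in> carrier_mat c r" and Y: "Y \<in> carrier_mat c r"
    using assms by (auto simp: r_def c_def is_moore_penrose_inverse_def)
  note x = assms(1)[unfolded is_moore_penrose_inverse_def]
  note y = assms(2)[unfolded is_moore_penrose_inverse_def]
  note [simp] = A X Y and assoc = assoc_mult_mat
  have AX: "A * X \<in> carrier_mat r r" and AY: "A * Y \<in> carrier_mat r r"
    and XA: "X * A \<in> carrier_mat c c" and YA: "Y * A \<in> carrier_mat c c"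
    using A X Y mult_carrier_mat by blast+
  have "A * X = (A * Y * A) * X" using y by simp
  also have "\<dots> = (A * Y) * (A * X)" by (rule assoc[OF AY A X])
  finally have 1: "A * X = (A * Y) * (A * X)" .
  have "A * Y = (A * X * A) * Y" using x by simp
  also have "\<dots> = (A * X) * (A * Y)" by (rule assoc[OF AX A Y])
  finally have 2: "A * Y = (A * X) * (A * Y)" .
  have "(A * X)\<^sup>T = (A * X)\<^sup>T * (A * Y)\<^sup>T"
    using arg_cong[OF 1, of transpose_mat] transpose_mult[OF AY AX] by simp
  then have AXY: "A * X = A * Y" using x y 2 by simp
  have "X * A = X * (A * Y * A)" using y by simp
  also have "\<dots> = X * (A * (Y * A))" by (simp add: assoc[OF A Y A])
  also have "\<dots> = (X * A) * (Y * A)" by (rule assoc[OF X A YA, symmetric])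
  finally have 3: "X * A = (X * A) * (Y * A)" .
  have "Y * A = Y * (A * X * A)" using x by simp
  also have "\<dots> = Y * (A * (X * A))" by (simp add: assoc[OF A X A])
  also have "\<dots> = (Y * A) * (X * A)" by (rule assoc[OF Y A XA, symmetric])
  finally have 4: "Y * A = (Y * A) * (X * A)" .
  have "(X * A)\<^sup>T = (Y * A)\<^sup>T * (X * A)\<^sup>T"
    using arg_cong[OF 3, of transpose_mat] transpose_mult[OF XA YA] by simp
  then have XAY: "X * A = Y * A" using x y 4 by simp
  have "X = X * A * X" using x by simp
  also have "\<dots> = Y * A * X" by (simp add: XAY)
  also have "\<dots> = Y * (A * X)" by (rule assoc[OF Y A X])
  also have "\<dots> = Y * (A * Y)" by (simp add: AXY)
  also have "\<dots> = Y * A * Y" by (rule assoc[OF Y A Y, symmetric])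
  also have "\<dots> = Y" using y by simp
  finally show ?thesis .
qed

definition range_mat :: "'a :: semiring_0 mat \<Rightarrow> 'a vec set" where
  "range_mat A = (\<lambda>x. A *\<^sub>v x) ` carrier_vec (dim_col A)"

definition negative_semidefinite_on :: "real mat \<Rightarrow> real vec set \<Rightarrow> bool" where
  "negative_semidefinite_on M W \<longleftrightarrow> M\<^sup>T = M \<and> (\<forall>x\<in>W. x \<bullet> (M *\<^sub>v x) \<le> 0)"

end

theory Submission
  imports Defs "Jordan_Normal_Form.Determinant"
begin

text \<open>
  The vector \<open>a\<close> spans the kernel of the symmetric matrix \<open>D\<close>, so \<open>M = D + aa\<^sup>t\<close> is invertible and
  \<open>DM\<^sup>-\<^sup>1 = M\<^sup>-\<^sup>1D = I - aa\<^sup>t/(a\<^sup>ta)\<close> is the orthogonal projection onto the range of \<open>D\<close>; the identities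
  follow from this and \<open>w\<^sup>ta = 0\<close>. For \<open>x = Dy\<close> one has \<open>x\<^sup>tM\<^sup>-\<^sup>1x = y\<^sup>tDy\<close>, and \<open>Dw\<close> is a multiple of the
  all-ones vector. Writing \<open>s\<close> for the sum of all entries of \<open>y\<close>, \<open>\<sigma>\<close> for the sum over the rim and
  \<open>m = n - 1\<close>, semidefiniteness becomes
  \<open>2\<sigma>s - ms\<^sup>2/4 \<le> \<Sum>(y\<^sub>i + y\<^sub>i\<^sub>+\<^sub>1)\<^sup>2\<close> with cyclic indices over the rim, which is
  \<open>0 \<le> \<Sum>(y\<^sub>i + y\<^sub>i\<^sub>+\<^sub>1 - s/2)\<^sup>2\<close> expanded.
\<close>

section \<open>Rank-one updates of singular symmetric matrices\<close>

lemma outer_square_carrier [simp]: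
  assumes "v \<in> carrier_vec n"
  shows "outer_square v \<in> carrier_mat n n"
  using assms unfolding carrier_mat_def by (simp add: outer_square_def)

lemma index_outer_square [simp]:
  assumes "i < dim_vec v" "j < dim_vec v"
  shows "outer_square v $$ (i, j) = v $ i * v $ j"
  using assms by (simp add: outer_square_def scalar_prod_def)

lemma dim_outer_square [simp]:
  "dim_row (outer_square v) = dim_vec v" "dim_col (outer_square v) = dim_vec v"
  by (simp_all add: outer_square_def)

lemma transpose_outer_square [simp]:
  fixes v :: "'a :: comm_semiring_0 vec"
  shows "(outer_square v)\<^sup>T = outer_square v"
  by (rule eq_matI) (auto simp: mult.commute)

lemma outer_square_mult_vec:
  fixes v x :: "'a :: comm_semiring_0 vec"
  assumes "v \<in> carrier_vec n" "x \<in> carrier_vec n"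
  shows "outer_square v *\<^sub>v x = (v \<bullet> x) \<cdot>\<^sub>v v"
  using assms
  by (intro eq_vecI) (auto simp: scalar_prod_def sum_distrib_left sum_distrib_right ac_simps)

lemma mult_outer_square:
  fixes v :: "'a :: comm_semiring_0 vec"
  assumes "A \<in> carrier_mat m n" "v \<in> carrier_vec n" "A *\<^sub>v v = c \<cdot>\<^sub>v u" "u \<in> carrier_vec m"
  shows "A * outer_square v = c \<cdot>\<^sub>m mat m n (\<lambda>(i, j). u $ i * v $ j)"
proof (rule eq_matI)
  fix i j assume "i < dim_row (c \<cdot>\<^sub>m mat m n (\<lambda>(i, j). u $ i * v $ j))"
    "j < dim_col (c \<cdot>\<^sub>m mat m n (\<lambda>(i, j). u $ i * v $ j))"
  then have ij: "i < m" "j < n" by auto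
  have "(A * outer_square v) $$ (i, j) = (A *\<^sub>v v) $ i * v $ j"
    using ij assms(1,2) by (simp add: scalar_prod_def sum_distrib_left ac_simps)
  then show "(A * outer_square v) $$ (i, j) = (c \<cdot>\<^sub>m mat m n (\<lambda>(i, j). u $ i * v $ j)) $$ (i, j)"
    using ij assms(3,4) by (simp add: ac_simps)
qed (use assms in auto)

lemma mult_outer_square_eigen:
  fixes v :: "'a :: comm_semiring_0 vec"
  assumes "A \<in> carrier_mat n n" "v \<in> carrier_vec n" "A *\<^sub>v v = c \<cdot>\<^sub>v v"
  shows "A * outer_square v = c \<cdot>\<^sub>m outer_square v"
  unfolding mult_outer_square[OF assms assms(2)]
  by (rule eq_matI) (use assms in auto)

lemma outer_square_mult_eigen:
  fixes v :: "'a :: comm_ring_1 vec"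
  assumes "A \<in> carrier_mat n n" "A\<^sup>T = A" "v \<in> carrier_vec n" "A *\<^sub>v v = c \<cdot>\<^sub>v v"
  shows "outer_square v * A = c \<cdot>\<^sub>m outer_square v"
proof -
  have "outer_square v * A = (A * outer_square v)\<^sup>T"
    using assms by (simp add: transpose_mult[where nr = n and n = n and nc = n])
  also have "\<dots> = c \<cdot>\<^sub>m outer_square v"
    by (simp add: mult_outer_square_eigen[OF assms(1,3,4)]) (rule eq_matI; use assms in auto)
  finally show ?thesis .
qed

lemma scalar_prod_mult_mat_vec_symmetric:
  fixes A :: "'a :: comm_semiring_0 mat"
  assumes "A \<in> carrier_mat n n" "A\<^sup>T = A" "x \<in> carrier_vec n" "y \<in> carrier_vec n"
  shows "x \<bullet> (A *\<^sub>v y) = (A *\<^sub>v x) \<bullet> y"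
  using transpose_vec_mult_scalar[OF assms(1,4,3)] assms
  by (metis comm_scalar_prod mult_mat_vec_carrier)

lemma inverse_mat_symmetric:
  fixes A :: "'a :: field mat"
  assumes A: "A \<in> carrier_mat n n" "A\<^sup>T = A" and B: "B \<in> carrier_mat n n"
    and inv: "A * B = 1\<^sub>m n" "B * A = 1\<^sub>m n"
  shows "B\<^sup>T = B"
proof -
  have "B\<^sup>T * A = (A * B)\<^sup>T"
    using A B by (simp add: transpose_mult[where nr = n and n = n and nc = n])
  then have *: "B\<^sup>T * A = 1\<^sub>m n" by (simp add: inv)
  have "B\<^sup>T = B\<^sup>T * (A * B)" using B by (simp add: inv)
  also have "\<dots> = (B\<^sup>T * A) * B" using A B by (simp add: assoc_mult_mat[where n\<^sub>1 = n and n\<^sub>2 = n and n\<^sub>3 = n and n\<^sub>4 = n])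
  also have "\<dots> = B" using B by (simp add: *)
  finally show ?thesis .
qed

text \<open>A trivial kernel makes the determinant nonzero and hence \<open>A\<close> a unit, so the
  option-valued \<open>mat_inverse\<close> is not \<open>None\<close> and \<open>the\<close> selects
  a genuine inverse.\<close>

lemma mat_inverse_of_trivial_kernel:
  fixes A :: "'a :: field mat"
  assumes A: "A \<in> carrier_mat n n"
    and ker: "\<And>x. x \<in> carrier_vec n \<Longrightarrow> A *\<^sub>v x = 0\<^sub>v n \<Longrightarrow> x = 0\<^sub>v n"
  shows "invertible_mat A" "the (mat_inverse A) \<in> carrier_mat n n"
    "A * the (mat_inverse A) = 1\<^sub>m n" "the (mat_inverse A) * A = 1\<^sub>m n"
proof -
  have "det A \<noteq> 0"
    using ker by (auto simp: det_0_iff_vec_prod_zero_field[OF A])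
  then have "A \<in> Units (ring_mat TYPE('a) n ())"
    by (rule det_non_zero_imp_unit[OF A])
  then obtain B where B: "mat_inverse A = Some B"
    using mat_inverse(1)[OF A, of "()"] by (cases "mat_inverse A") auto
  note inv = mat_inverse(2)[OF A B]
  show "the (mat_inverse A) \<in> carrier_mat n n"
    "A * the (mat_inverse A) = 1\<^sub>m n" "the (mat_inverse A) * A = 1\<^sub>m n"
    using inv by (simp_all add: B)
  show "invertible_mat A"
    using inv A unfolding invertible_mat_def inverts_mat_def square_mat.simps by auto
qed

section \<open>Inverse and Moore-Penrose inverse when the kernel is a line\<close>

locale rank_one_update =
  fixes n :: nat and D :: "real mat" and a :: "real vec" and k :: real
  assumes D: "D \<in> carrier_mat n n" and D_sym: "D\<^sup>T = D"
    and a: "a \<in> carrier_vec n" and Da: "D *\<^sub>v a = 0\<^sub>v n"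
    and aa: "a \<bullet> a = k" and k: "k \<noteq> 0"
    and ker: "\<And>x. x \<in> carrier_vec n \<Longrightarrow> D *\<^sub>v x = 0\<^sub>v n \<Longrightarrow> a \<bullet> x = 0 \<Longrightarrow> x = 0\<^sub>v n"
begin

definition M where "M = D + outer_square a"
definition N where "N = the (mat_inverse M)"
definition P where "P = 1\<^sub>m n - (1 / k) \<cdot>\<^sub>m outer_square a"

lemma M: "M \<in> carrier_mat n n"
  using D a by (simp add: M_def)

lemma M_sym: "M\<^sup>T = M"
  using D D_sym a by (simp add: M_def transpose_add[where nr = n and nc = n])

lemma M_mult_vec:
  assumes "x \<in> carrier_vec n"
  shows "M *\<^sub>v x = D *\<^sub>v x + (a \<bullet> x) \<cdot>\<^sub>v a"
  using assms D a
  by (simp add: M_def add_mult_distrib_mat_vec[where nr = n and nc = n] outer_square_mult_vec)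

lemma M_mult_a: "M *\<^sub>v a = k \<cdot>\<^sub>v a"
  using a by (simp add: M_mult_vec Da aa)

text \<open>Pairing \<open>M x = 0\<close> with the eigenvector \<open>a\<close> gives
  \<open>k * (a . x) = 0\<close>. Hence \<open>M x = D x\<close>, so \<open>x\<close> is a kernel
  vector of \<open>D\<close> orthogonal to \<open>a\<close>, which the locale assumption
  \<open>ker\<close> excludes unless \<open>x\<close> is zero.\<close>

lemma kernel_M:
  assumes x: "x \<in> carrier_vec n" and Mx: "M *\<^sub>v x = 0\<^sub>v n"
  shows "x = 0\<^sub>v n"
proof (rule ker[OF x])
  have "0 = a \<bullet> (M *\<^sub>v x)" using a by (simp add: Mx)
  also have "\<dots> = k * (a \<bullet> x)"
    using x a by (simp add: scalar_prod_mult_mat_vec_symmetric[OF M M_sym a x] M_mult_a)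
  finally show "a \<bullet> x = 0" using k by simp
  moreover have "D *\<^sub>v x + 0 \<cdot>\<^sub>v a = D *\<^sub>v x"
    using a D by (intro eq_vecI) auto
  ultimately show "D *\<^sub>v x = 0\<^sub>v n"
    using Mx x by (simp add: M_mult_vec)
qed

lemmas invertible_M = mat_inverse_of_trivial_kernel(1)[OF M kernel_M]
  and N = mat_inverse_of_trivial_kernel(2)[OF M kernel_M, folded N_def]
  and MN = mat_inverse_of_trivial_kernel(3)[OF M kernel_M, folded N_def]
  and NM = mat_inverse_of_trivial_kernel(4)[OF M kernel_M, folded N_def]

lemma N_sym: "N\<^sup>T = N"
  by (rule inverse_mat_symmetric[OF M M_sym N MN NM])

lemma N_mult_a: "N *\<^sub>v a = (1 / k) \<cdot>\<^sub>v a"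
proof -
  have "a = N *\<^sub>v (M *\<^sub>v a)"
    using a by (simp add: assoc_mult_mat_vec[OF N M, symmetric] NM)
  also have "\<dots> = k \<cdot>\<^sub>v (N *\<^sub>v a)"
    by (simp add: M_mult_a mult_mat_vec[OF N a])
  finally have "(1 / k) \<cdot>\<^sub>v a = (1 / k) \<cdot>\<^sub>v (k \<cdot>\<^sub>v (N *\<^sub>v a))" by simp
  then show ?thesis using k by (simp add: smult_smult_assoc)
qed

lemma P: "P \<in> carrier_mat n n"
  using a by (simp add: P_def minus_carrier_mat)

lemma P_sym: "P\<^sup>T = P"
  using a by (intro eq_matI) (auto simp: P_def)

text \<open>Multiply \<open>D = M - aa^t\<close> by \<open>N\<close> on the right:
  \<open>M N\<close> is the identity, and symmetry of \<open>N\<close> with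
  \<open>N a = a / k\<close> turns \<open>aa^t N\<close> into \<open>aa^t / k\<close>.\<close>

lemma DN: "D * N = P"
proof -
  have "D = M - outer_square a"
    using D a by (intro eq_matI) (auto simp: M_def)
  then have "D * N = M * N - outer_square a * N"
    using minus_mult_distrib_mat[OF M outer_square_carrier[OF a] N] by simp
  then show ?thesis
    by (simp add: MN P_def outer_square_mult_eigen[OF N N_sym a N_mult_a])
qed

lemma ND: "N * D = P"
proof -
  have "N * D = (D * N)\<^sup>T"
    using D N by (simp add: transpose_mult[where nr = n and n = n and nc = n] D_sym N_sym)
  then show ?thesis by (simp add: DN P_sym)
qed

text \<open>\<open>A P\<close> differs from \<open>A\<close> by a multiple of
  \<open>(A a) a^t\<close>. Stated for a general \<open>A\<close> because it serves both
  \<open>D\<close> and the matrix \<open>ww^t\<close>.\<close>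

lemma mult_P_of_orthogonal:
  assumes A: "A \<in> carrier_mat n n" and Aa: "A *\<^sub>v a = 0\<^sub>v n"
  shows "A * P = A"
proof -
  have "A * outer_square a = 0 \<cdot>\<^sub>m outer_square a"
    by (rule mult_outer_square_eigen[OF A a]) (use Aa a in auto)
  also have "\<dots> = 0\<^sub>m n n" using a by auto
  finally have "A * outer_square a = 0\<^sub>m n n" .
  moreover have "A - 0\<^sub>m n n = A"
    using A by (intro eq_matI) auto
  ultimately show ?thesis
    using A a
    by (simp add: P_def mult_minus_distrib_mat[where nr = n and n = n and nc = n]
        mult_smult_distrib[OF A outer_square_carrier[OF a]])
qed

lemma DP: "D * P = D"
  by (rule mult_P_of_orthogonal[OF D Da])

lemma PD: "P * D = D"
proof -
  have "P * D = (D * P)\<^sup>T"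
    using D P by (simp add: transpose_mult[where nr = n and n = n and nc = n] D_sym P_sym)
  then show ?thesis by (simp add: DP D_sym)
qed

text \<open>Bracket \<open>N D P\<close> in two ways; \<open>N D N\<close> gives \<open>PN\<close>
  in the same manner.\<close>

lemma PP: "P * P = P"
  using assoc_mult_mat[OF N D P] unfolding ND DP .

lemma PN: "P * N = N * P"
  using assoc_mult_mat[OF N D N] unfolding ND DN .

text \<open>Both products of \<open>D\<close> with \<open>N P\<close> equal the symmetric matrix
  \<open>P\<close>, and \<open>P\<close> fixes \<open>D\<close> and \<open>N P\<close> from the
  left. These are the four Penrose equations.\<close>

lemma is_moore_penrose_inverse_NP: "is_moore_penrose_inverse D (N * P)"
proof -
  have DX: "D * (N * P) = P"
    using assoc_mult_mat[OF D N P] unfolding DN PP by (rule sym)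
  have XD: "N * P * D = P"
    using assoc_mult_mat[OF N P D] unfolding PD ND .
  have PX: "P * (N * P) = N * P"
    using assoc_mult_mat[OF P N P] assoc_mult_mat[OF N P P] unfolding PN PP by simp
  show ?thesis
    unfolding is_moore_penrose_inverse_def DX XD PX
    using D N P by (simp add: PD P_sym)
qed

lemma moore_penrose_inverse_eq: "moore_penrose_inverse D = N * P"
  unfolding moore_penrose_inverse_def
  using is_moore_penrose_inverse_NP is_moore_penrose_inverse_unique by blast

text \<open>This is \<open>D N D = D P = D\<close>. On the range of \<open>D\<close> the form of
  \<open>N\<close> pulls back to that of \<open>D\<close>, so \<open>N\<close> is never computed
  explicitly.\<close>

lemma quadratic_form_N_on_range:
  assumes y: "y \<in> carrier_vec n"
  shows "(D *\<^sub>v y) \<bullet> (N *\<^sub>v (D *\<^sub>v y)) = y \<bullet> (D *\<^sub>v y)"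
proof -
  have "(D *\<^sub>v y) \<bullet> (N *\<^sub>v (D *\<^sub>v y)) = y \<bullet> (D *\<^sub>v (P *\<^sub>v y))"
    using scalar_prod_mult_mat_vec_symmetric[OF D D_sym y, of "P *\<^sub>v y"] D N P y
    by (simp add: assoc_mult_mat_vec[OF N D, symmetric] ND)
  also have "\<dots> = y \<bullet> (D *\<^sub>v y)"
    using y by (simp add: assoc_mult_mat_vec[OF D P, symmetric] DP)
  finally show ?thesis .
qed

end

section \<open>The wheel distance matrix\<close>

text \<open>Indices are vertex labels minus one: the hub is 0 and the rim is 1 to
  \<open>n - 1\<close>. The explicit wrap-around replaces arithmetic modulo \<open>n - 1\<close>
  with an offset.\<close>

definition rim_succ :: "nat \<Rightarrow> nat \<Rightarrow> nat" where
  "rim_succ n i = (if i = n - 1 then 1 else i + 1)"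

lemma bij_betw_rim_succ: "bij_betw (rim_succ n) {1..<n} {1..<n}"
  by (rule bij_betw_byWitness[where f' = "\<lambda>i. if i = 1 then n - 1 else i - 1"])
     (auto simp: rim_succ_def)

lemma rim_succ_in: "i \<in> {1..<n} \<Longrightarrow> rim_succ n i \<in> {1..<n}"
  using bij_betwE[OF bij_betw_rim_succ] by blast

lemma rim_succ_eq_iff:
  "i \<in> {1..<n} \<Longrightarrow> j \<in> {1..<n} \<Longrightarrow> rim_succ n i = rim_succ n j \<longleftrightarrow> i = j"
  using bij_betw_imp_inj_on[OF bij_betw_rim_succ] by (rule inj_on_eq_iff)

lemma sum_rim_succ: "(\<Sum>i\<in>{1..<n}. f (rim_succ n i)) = sum f {1..<n}"
  by (rule sum.reindex_bij_betw[OF bij_betw_rim_succ])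

lemma wheel_distance_matrix_carrier [simp]: "wheel_distance_matrix n \<in> carrier_mat n n"
  by (simp add: wheel_distance_matrix_def)

lemma wheel_distance_matrix_dims [simp]:
  "dim_row (wheel_distance_matrix n) = n" "dim_col (wheel_distance_matrix n) = n"
  by (simp_all add: wheel_distance_matrix_def)

text \<open>Two rim vertices are at distance 2 through the hub, corrected at the vertex itself and
  at its two neighbours. Writing the corrections as a sum makes row sums split linearly.\<close>

lemma index_wheel_distance_matrix:
  assumes "n \<ge> 5" "i < n" "j < n"
  shows "wheel_distance_matrix n $$ (i, j) =
    (if i = 0 \<or> j = 0 then of_bool (i \<noteq> j)
     else 2 - 2 * of_bool (j = i) - of_bool (j = rim_succ n i) - of_bool (i = rim_succ n j))"
proof -
  have D: "wheel_distance_matrix n $$ (i, j) =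
      (if i = j then 0 else if (i + 1, j + 1) \<in> parcs (wheel_graph n) then 1 else 2)"
    using assms by (simp add: wheel_distance_matrix_def graph_dist_wheel_graph)
  show ?thesis
  proof (cases "i = 0 \<or> j = 0")
    case True
    then have "i \<noteq> j \<Longrightarrow> (i + 1, j + 1) \<in> parcs (wheel_graph n)"
      unfolding wheel_graph_simps(2) atLeastLessThan_iff atLeastAtMost_iff
      using assms by presburger
    with True show ?thesis unfolding D by simp
  next
    case False
    then have adj: "(i + 1, j + 1) \<in> parcs (wheel_graph n) \<longleftrightarrow> j = rim_succ n i \<or> i = rim_succ n j"
      unfolding wheel_graph_simps(2) rim_succ_def atLeastLessThan_iff atLeastAtMost_iff
      using assms by presburger
    \<comment> \<open>The rim has more than two vertices, so the three corrections never
      overlap.\<close>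
    have neq: "rim_succ n i \<noteq> i" "rim_succ n j \<noteq> j" "\<not> (j = rim_succ n i \<and> i = rim_succ n j)"
      using assms unfolding rim_succ_def by presburger+
    show ?thesis
    proof (cases "i = j")
      case True
      then show ?thesis unfolding D using False neq(1,2)[symmetric] by simp
    next
      case ij: False
      define A B where "A \<longleftrightarrow> j = rim_succ n i" and "B \<longleftrightarrow> i = rim_succ n j"
      have "\<not> (A \<and> B)" using neq(3) unfolding A_def B_def .
      with ij False show ?thesis
        unfolding D adj A_def[symmetric] B_def[symmetric] by auto
    qed
  qed
qed

lemma transpose_wheel_distance_matrix:
  assumes "n \<ge> 5"
  shows "(wheel_distance_matrix n)\<^sup>T = wheel_distance_matrix n"
  by (rule eq_matI) (use assms in \<open>auto simp: index_wheel_distance_matrix\<close>)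

section \<open>Products with the matrix, its quadratic form and its kernel\<close>

lemma scalar_prod_hub_rim:
  assumes "n \<ge> 1" "y \<in> carrier_vec n"
  shows "x \<bullet> y = x $ 0 * y $ 0 + (\<Sum>i\<in>{1..<n}. x $ i * y $ i)"
  using assms by (simp add: scalar_prod_def sum.atLeast_Suc_lessThan)

lemma index_mult_wheel_distance_matrix:
  assumes "i < n" "y \<in> carrier_vec n"
  shows "(wheel_distance_matrix n *\<^sub>v y) $ i =
    wheel_distance_matrix n $$ (i, 0) * y $ 0 + (\<Sum>j\<in>{1..<n}. wheel_distance_matrix n $$ (i, j) * y $ j)"
  using assms by (simp add: scalar_prod_hub_rim[OF _ assms(2)])

lemma wheel_distance_matrix_mult_hub:
  assumes "n \<ge> 5" "y \<in> carrier_vec n"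
  shows "(wheel_distance_matrix n *\<^sub>v y) $ 0 = (\<Sum>i\<in>{1..<n}. y $ i)"
  using assms
  by (simp add: index_mult_wheel_distance_matrix[OF _ assms(2)] index_wheel_distance_matrix del: index_mult_mat_vec)

text \<open>Rows are indexed by successors so that both neighbours are images under \<open>rim_succ\<close>.\<close>

lemma wheel_distance_matrix_mult_rim:
  assumes n: "n \<ge> 5" and y: "y \<in> carrier_vec n" and i: "i \<in> {1..<n}"
  defines "p \<equiv> \<lambda>i. y $ i + y $ rim_succ n i"
  shows "(wheel_distance_matrix n *\<^sub>v y) $ rim_succ n i =
    y $ 0 + 2 * (\<Sum>j\<in>{1..<n}. y $ j) - p i - p (rim_succ n i)"
proof -
  let ?i = "rim_succ n i"
  have si: "?i \<in> {1..<n}" "rim_succ n ?i \<in> {1..<n}"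
    using i by (blast intro: rim_succ_in)+
  have "(wheel_distance_matrix n *\<^sub>v y) $ ?i = y $ 0 +
      (\<Sum>j\<in>{1..<n}. wheel_distance_matrix n $$ (?i, j) * y $ j)"
    using n y si by (simp add: index_mult_wheel_distance_matrix[OF _ y] index_wheel_distance_matrix del: index_mult_mat_vec)
  \<comment> \<open>Injectivity of \<open>rim_succ\<close> turns the condition
    \<open>?i = rim_succ n j\<close> into \<open>j = i\<close>.\<close>
  also have "(\<Sum>j\<in>{1..<n}. wheel_distance_matrix n $$ (?i, j) * y $ j) =
      (\<Sum>j\<in>{1..<n}. 2 * y $ j - 2 * (if j = ?i then y $ j else 0)
         - (if j = rim_succ n ?i then y $ j else 0) - (if j = i then y $ j else 0))"
    by (rule sum.cong) (use n si i rim_succ_eq_iff in \<open>auto simp: index_wheel_distance_matrix algebra_simps\<close>)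
  also have "\<dots> = 2 * (\<Sum>j\<in>{1..<n}. y $ j) - 2 * y $ ?i - y $ rim_succ n ?i - y $ i"
    using si i by (simp add: sum_subtractf sum_distrib_left[symmetric])
  finally show ?thesis by (simp add: p_def)
qed

text \<open>The rim block is twice the all-ones matrix minus the signless Laplacian of the cycle,
  whose quadratic form is the sum of the squares of \<open>y_i + y_{i+1}\<close>.\<close>

lemma wheel_distance_matrix_quadratic_form:
  assumes n: "n \<ge> 5" and y: "y \<in> carrier_vec n"
  defines "\<sigma> \<equiv> \<Sum>i\<in>{1..<n}. y $ i"
  shows "y \<bullet> (wheel_distance_matrix n *\<^sub>v y) =
    2 * \<sigma> * (y $ 0 + \<sigma>) - (\<Sum>i\<in>{1..<n}. (y $ i + y $ rim_succ n i)\<^sup>2)"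
proof -
  let ?D = "wheel_distance_matrix n" and ?s = "rim_succ n"
  define p where "p i = y $ i + y $ ?s i" for i
  have "(\<Sum>i\<in>{1..<n}. y $ i * (?D *\<^sub>v y) $ i) = (\<Sum>i\<in>{1..<n}. y $ ?s i * (?D *\<^sub>v y) $ ?s i)"
    by (rule sum_rim_succ[symmetric])
  also have "\<dots> = (\<Sum>i\<in>{1..<n}. y $ ?s i * (y $ 0 + 2 * \<sigma>) - y $ ?s i * p i - y $ ?s i * p (?s i))"
    by (rule sum.cong)
       (simp_all add: wheel_distance_matrix_mult_rim[OF n y] \<sigma>_def p_def algebra_simps del: index_mult_mat_vec)
  \<comment> \<open>Shifting the last sum back by one index gives both sums the same factor
    \<open>p i\<close>; their coefficients then add up to \<open>p i\<close> as well.\<close>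
  also have "\<dots> = \<sigma> * (y $ 0 + 2 * \<sigma>) - (\<Sum>i\<in>{1..<n}. y $ ?s i * p i) - (\<Sum>i\<in>{1..<n}. y $ i * p i)"
    by (simp only: sum_subtractf sum_distrib_right[symmetric] sum_rim_succ[of "\<lambda>i. y $ i"]
        sum_rim_succ[of "\<lambda>i. y $ i * p i"] \<sigma>_def[symmetric])
  also have "\<dots> = \<sigma> * (y $ 0 + 2 * \<sigma>) - (\<Sum>i\<in>{1..<n}. (p i)\<^sup>2)"
    by (simp add: p_def sum.distrib[symmetric] diff_diff_eq power2_eq_square algebra_simps)
  finally have rim: "(\<Sum>i\<in>{1..<n}. y $ i * (?D *\<^sub>v y) $ i) = \<dots>" .
  have "y \<bullet> (?D *\<^sub>v y) = y $ 0 * (?D *\<^sub>v y) $ 0 + (\<Sum>i\<in>{1..<n}. y $ i * (?D *\<^sub>v y) $ i)"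
    using n y by (intro scalar_prod_hub_rim mult_mat_vec_carrier) auto
  then show ?thesis
    unfolding rim wheel_distance_matrix_mult_hub[OF n y] \<sigma>_def[symmetric] p_def
    by (simp add: algebra_simps)
qed

text \<open>With constant neighbour sums \<open>d\<close>, every rim entry of the product is
  \<open>y_0 + 2c - 2d\<close>, which \<open>eq\<close> makes equal to the hub entry
  \<open>c\<close>. Covers both \<open>a\<close> and \<open>w\<close>.\<close>

lemma wheel_distance_matrix_mult_eqI:
  assumes n: "n \<ge> 5" and y: "y \<in> carrier_vec n"
    and hub: "(\<Sum>i\<in>{1..<n}. y $ i) = c"
    and rim: "\<And>i. i \<in> {1..<n} \<Longrightarrow> y $ i + y $ rim_succ n i = d"
    and eq: "y $ 0 + c = 2 * d"
  shows "wheel_distance_matrix n *\<^sub>v y = vec n (\<lambda>_. c)"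
proof (rule eq_vecI)
  fix i assume "i < dim_vec (vec n (\<lambda>_. c))"
  then have "i < n" by simp
  then have "i \<noteq> 0 \<Longrightarrow> i \<in> rim_succ n ` {1..<n}"
    by (simp add: bij_betw_imp_surj_on[OF bij_betw_rim_succ] del: One_nat_def)
  then consider "i = 0" | k where "k \<in> {1..<n}" "i = rim_succ n k"
    by blast
  then have "(wheel_distance_matrix n *\<^sub>v y) $ i = c"
  proof cases
    case 1
    then show ?thesis using wheel_distance_matrix_mult_hub[OF n y] hub by simp
  next
    case (2 k)
    then show ?thesis
      using wheel_distance_matrix_mult_rim[OF n y 2(1)] rim[OF 2(1)] rim[OF rim_succ_in[OF 2(1)]] hub eq
      by simp
  qed
  then show "(wheel_distance_matrix n *\<^sub>v y) $ i = vec n (\<lambda>_. c) $ i"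
    using \<open>i < n\<close> by simp
qed simp

text \<open>The hub row gives rim sum zero. The quadratic form then leaves a vanishing sum of
  squares, so neighbouring rim entries are opposite, and any rim row reduces to
  \<open>y_0 = 0\<close>. The sign in \<open>- y $ 1\<close> compensates for the exponent starting
  at 1.\<close>

lemma wheel_distance_matrix_kernel:
  assumes n: "n \<ge> 5" and y: "y \<in> carrier_vec n" and Dy: "wheel_distance_matrix n *\<^sub>v y = 0\<^sub>v n"
  shows "y $ 0 = 0" and "i \<in> {1..<n} \<Longrightarrow> y $ i = (- 1) ^ i * (- y $ 1)"
proof -
  have \<sigma>: "(\<Sum>i\<in>{1..<n}. y $ i) = 0"
    using wheel_distance_matrix_mult_hub[OF n y] n by (simp add: Dy)
  have "(\<Sum>i\<in>{1..<n}. (y $ i + y $ rim_succ n i)\<^sup>2) = 0"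
    using wheel_distance_matrix_quadratic_form[OF n y] y unfolding Dy \<sigma> by simp
  then have p: "y $ i + y $ rim_succ n i = 0" if "i \<in> {1..<n}" for i
    using that by (subst (asm) sum_nonneg_eq_0_iff) auto
  have 1: "1 \<in> {1..<n}" using n by simp
  show "y $ 0 = 0"
    using wheel_distance_matrix_mult_rim[OF n y 1] p[OF 1] p[OF rim_succ_in[OF 1]] rim_succ_in[OF 1]
    unfolding Dy \<sigma> by simp
  have "y $ i = (- 1) ^ i * (- y $ 1)" if "1 \<le> i" "i < n" for i
    using that
  proof (induction i rule: dec_induct)
    case (step i)
    then have "rim_succ n i = Suc i" by (simp add: rim_succ_def)
    then have "y $ Suc i = - y $ i" using p[of i] step.hyps step.prems by simp
    also have "y $ i = (- 1) ^ i * (- y $ 1)" using step.IH step.hyps step.prems by linarith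
    finally show ?case by (simp only: power_Suc mult.assoc mult_minus1)
  qed simp
  then show "i \<in> {1..<n} \<Longrightarrow> y $ i = (- 1) ^ i * (- y $ 1)"
    unfolding atLeastLessThan_iff by blast
qed

section \<open>The alternating sum and the semidefiniteness inequality\<close>

lemma sum_alternating_rim:
  assumes "odd n"
  shows "(\<Sum>i\<in>{1..<n}. (- 1) ^ i) = (0 :: 'a :: ring_1)"
proof -
  obtain m where "n = 2 * m + 1" using assms by (rule oddE)
  then show ?thesis by (induction m arbitrary: n) simp_all
qed

text \<open>The right side is the value of \<open>4/(n-1) ww^t\<close> at \<open>D y\<close>,
  because \<open>w . D y\<close> is \<open>(n-1)/4\<close> times the sum of the entries of
  \<open>y\<close>.\<close>

lemma wheel_quadratic_inequality:
  assumes n: "n \<ge> 5" and y: "y \<in> carrier_vec n"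
  shows "y \<bullet> (wheel_distance_matrix n *\<^sub>v y) \<le> (real n - 1) / 4 * (\<Sum>i\<in>{0..<n}. y $ i)\<^sup>2"
proof -
  let ?m = "real n - 1"
  define \<sigma> where "\<sigma> = (\<Sum>i\<in>{1..<n}. y $ i)"
  define s where "s = (\<Sum>i\<in>{0..<n}. y $ i)"
  define p where "p i = y $ i + y $ rim_succ n i" for i
  define Q where "Q = (\<Sum>i\<in>{1..<n}. (p i)\<^sup>2)"
  have s: "s = y $ 0 + \<sigma>"
    using n by (simp add: s_def \<sigma>_def sum.atLeast_Suc_lessThan)
  have sum_p: "(\<Sum>i\<in>{1..<n}. p i) = 2 * \<sigma>"
    by (simp only: p_def sum.distrib sum_rim_succ[of "\<lambda>i. y $ i"] \<sigma>_def mult_2)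
  \<comment> \<open>With the shift \<open>s / 2\<close> the cross term is \<open>s\<close> times the
    sum of the \<open>p i\<close>, which is the required 2 \<sigma> s.\<close>
  have "0 \<le> (\<Sum>i\<in>{1..<n}. (p i - s / 2)\<^sup>2)"
    by (rule sum_nonneg) simp
  also have "\<dots> = (\<Sum>i\<in>{1..<n}. (p i)\<^sup>2 - p i * s + s\<^sup>2 / 4)"
    by (rule sum.cong) (simp_all add: power2_eq_square field_simps)
  also have "\<dots> = Q - 2 * \<sigma> * s + ?m / 4 * s\<^sup>2"
    unfolding sum.distrib sum_subtractf sum_distrib_right[symmetric] sum_p Q_def
    using n by (simp add: of_nat_diff)
  finally have "2 * \<sigma> * s - Q \<le> ?m / 4 * s\<^sup>2" by simp
  then show ?thesis
    using wheel_distance_matrix_quadratic_form[OF n y]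
    by (simp add: \<sigma>_def[symmetric] Q_def p_def s s_def[symmetric] del: One_nat_def)
qed

section \<open>Specialisation to the wheel\<close>

theorem proposition5p7:
  fixes n :: nat and D L Minv :: "real mat" and a w :: "real vec"
  assumes "n \<ge> 5" and "odd n"
  defines "D \<equiv> wheel_distance_matrix n"
    and "a \<equiv> vec n (\<lambda>i. if i = 0 then 0 else (- 1) ^ i)"
    and "w \<equiv> (1 / 4) \<cdot>\<^sub>v vec n (\<lambda>i. if i = 0 then 5 - real n else 1)"
    and "Minv \<equiv> the (mat_inverse (D + outer_square a))"
  assumes "L \<in> carrier_mat n n"
    and "moore_penrose_inverse D =
           (- 1 / 2) \<cdot>\<^sub>m L + (4 / (real n - 1)) \<cdot>\<^sub>m outer_square w"
  shows "invertible_mat (D + outer_square a)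
         \<and> Minv *\<^sub>v a = (1 / (real n - 1)) \<cdot>\<^sub>v a
         \<and> moore_penrose_inverse D =
           Minv * (1\<^sub>m n - (1 / (real n - 1)) \<cdot>\<^sub>m outer_square a)
         \<and> L = (- 2) \<cdot>\<^sub>m ((Minv - (4 / (real n - 1)) \<cdot>\<^sub>m outer_square w) *
           (1\<^sub>m n - (1 / (real n - 1)) \<cdot>\<^sub>m outer_square a))
         \<and> negative_semidefinite_on
           (Minv - (4 / (real n - 1)) \<cdot>\<^sub>m outer_square w) (range_mat D)"
proof -
  let ?m = "real n - 1"
  note n = assms(1)
  have m: "?m > 0" using n by simp
  have a: "a \<in> carrier_vec n" and w: "w \<in> carrier_vec n"
    by (simp_all add: a_def w_def)
  have D: "D \<in> carrier_mat n n" by (simp add: D_def)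
  have sum_a: "(\<Sum>i\<in>{1..<n}. a $ i) = 0"
    using sum_alternating_rim[OF assms(2), where 'a = real] by (simp add: a_def)
  \<comment> \<open>Parity matters at the wrap-around: \<open>n - 1\<close> is even, so the last rim
    entry is 1 and the first is -1.\<close>
  have rim_a: "a $ i + a $ rim_succ n i = 0" if "i \<in> {1..<n}" for i
    using that assms(2) n by (auto simp: a_def rim_succ_def)
  have Da: "D *\<^sub>v a = 0\<^sub>v n"
    using wheel_distance_matrix_mult_eqI[OF n a sum_a rim_a] n
    by (simp add: a_def D_def zero_vec_def)
  \<comment> \<open>Applied with \<open>c = 1\<close> to the norm of \<open>a\<close>, and with
    \<open>c = - x $ 1\<close> to kernel vectors of \<open>D\<close>.\<close>
  have a_prod: "a \<bullet> x = c * ?m" if x: "x \<in> carrier_vec n" "\<And>i. i \<in> {1..<n} \<Longrightarrow> x $ i = (- 1) ^ i * c" for x c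
  proof -
    have "a \<bullet> x = (\<Sum>i\<in>{1..<n}. a $ i * x $ i)"
      using n by (subst scalar_prod_hub_rim[OF _ x(1)]) (auto simp: a_def)
    also have "\<dots> = (\<Sum>i\<in>{1..<n}. c)"
      by (rule sum.cong) (auto simp: a_def x(2) simp flip: power_add mult.assoc)
    finally show ?thesis using n by (simp add: of_nat_diff)
  qed
  have aa: "a \<bullet> a = ?m"
    using a_prod[OF a, of 1] by (simp add: a_def)
  have ker: "x = 0\<^sub>v n" if x: "x \<in> carrier_vec n" "D *\<^sub>v x = 0\<^sub>v n" "a \<bullet> x = 0" for x
  proof -
    note k = wheel_distance_matrix_kernel[OF n x(1) x(2)[unfolded D_def]]
    have "x $ 1 = 0" using a_prod[OF x(1) k(2)] x(3) m by simp
    then have "x $ i = 0" if "i < n" for i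
      using k(1) k(2)[of i] that by (cases "i = 0") auto
    then show ?thesis using x(1) by auto
  qed
  interpret R: rank_one_update n D a ?m
    by unfold_locales
       (use D a Da aa m ker transpose_wheel_distance_matrix[OF n] in \<open>auto simp: D_def\<close>)
  have N: "Minv = R.N" by (simp add: Minv_def R.N_def R.M_def)
  have wa: "w \<bullet> a = 0"
  proof -
    have "w \<bullet> a = (\<Sum>i\<in>{1..<n}. (1 / 4) * a $ i)"
      using n by (subst scalar_prod_hub_rim[OF _ a]) (auto simp: a_def w_def)
    then show ?thesis using sum_a by (simp add: sum_divide_distrib[symmetric])
  qed
  let ?W = "(4 / ?m) \<cdot>\<^sub>m outer_square w"
  have W: "?W \<in> carrier_mat n n" using w by simp
  have W_vec: "?W *\<^sub>v x = (4 / ?m * (w \<bullet> x)) \<cdot>\<^sub>v w" if "x \<in> carrier_vec n" for x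
    using that w by (intro eq_vecI) (auto simp: scalar_prod_def sum_distrib_left sum_distrib_right ac_simps)
  \<comment> \<open>Orthogonality of \<open>w\<close> and \<open>a\<close> means that the projection
    leaves \<open>ww^t\<close> unchanged.\<close>
  have "?W * R.P = ?W"
    by (rule R.mult_P_of_orthogonal[OF W]) (use a w in \<open>auto simp: W_vec wa\<close>)
  then have NWP: "(R.N - ?W) * R.P = R.N * R.P - ?W"
    using R.N R.P W by (simp add: minus_mult_distrib_mat[where nr = n and n = n and nc = n])
  have NP: "R.N * R.P = (- 1 / 2) \<cdot>\<^sub>m L + ?W"
    using assms(8) R.moore_penrose_inverse_eq by simp
  \<comment> \<open>By the assumed decomposition, \<open>R.N * R.P - ?W\<close> is
    \<open>-L/2\<close>.\<close>
  have L: "L = (- 2) \<cdot>\<^sub>m ((R.N - ?W) * R.P)"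
    unfolding NWP NP by (rule eq_matI) (use assms(7) w in auto)
  \<comment> \<open>Neighbour sums on the rim are 1/2 and the rim sum is \<open>(n-1)/4\<close>; the
    hub entry \<open>(5-n)/4\<close> is what brings the total to 1, twice the neighbour sum.\<close>
  have Dw: "D *\<^sub>v w = vec n (\<lambda>_. ?m / 4)"
    unfolding D_def
    by (rule wheel_distance_matrix_mult_eqI[OF n w, of _ "1 / 2"])
       (use n in \<open>auto simp: w_def rim_succ_def of_nat_diff field_simps\<close>)
  have "x \<bullet> ((R.N - ?W) *\<^sub>v x) \<le> 0" if "x \<in> range_mat D" for x
  proof -
    obtain y where y: "y \<in> carrier_vec n" and x: "x = D *\<^sub>v y"
      using \<open>x \<in> range_mat D\<close> D by (auto simp: range_mat_def)
    have xc: "x \<in> carrier_vec n" using D y by (simp add: x)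
    \<comment> \<open>Moving \<open>D\<close> onto \<open>w\<close> leaves only the sum of the
      entries of \<open>y\<close>.\<close>
    have "w \<bullet> x = vec n (\<lambda>_. ?m / 4) \<bullet> y"
      unfolding x by (simp only: scalar_prod_mult_mat_vec_symmetric[OF D R.D_sym w y] Dw)
    also have "\<dots> = ?m / 4 * (\<Sum>i\<in>{0..<n}. y $ i)"
      using y by (simp add: scalar_prod_def sum_distrib_left)
    finally have wx: "w \<bullet> x = \<dots>" .
    have "x \<bullet> ((R.N - ?W) *\<^sub>v x) = x \<bullet> (R.N *\<^sub>v x) - x \<bullet> (?W *\<^sub>v x)"
      using xc R.N W
      by (simp add: minus_mult_distrib_mat_vec[where nr = n and nc = n] scalar_prod_minus_distrib[where n = n])
    also have "x \<bullet> (?W *\<^sub>v x) = 4 / ?m * (w \<bullet> x)\<^sup>2"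
      using xc w by (simp add: W_vec comm_scalar_prod[of x n w] power2_eq_square)
    also have "\<dots> = ?m / 4 * (\<Sum>i\<in>{0..<n}. y $ i)\<^sup>2"
      using m by (simp add: wx power2_eq_square field_simps)
    also have "x \<bullet> (R.N *\<^sub>v x) = y \<bullet> (D *\<^sub>v y)"
      unfolding x by (rule R.quadratic_form_N_on_range[OF y])
    finally show ?thesis
      using wheel_quadratic_inequality[OF n y] by (simp add: D_def)
  qed
  moreover have "(R.N - ?W)\<^sup>T = R.N - ?W"
  proof -
    have "?W\<^sup>T = ?W" by (rule eq_matI) (use w in auto)
    then show ?thesis using R.N W by (simp add: transpose_minus[where nr = n and nc = n] R.N_sym)
  qed
  ultimately have "negative_semidefinite_on (R.N - ?W) (range_mat D)"
    by (simp add: negative_semidefinite_on_def)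
  with R.invertible_M R.N_mult_a R.moore_penrose_inverse_eq L show ?thesis
    unfolding N R.M_def R.P_def by (intro conjI)
qed

end
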